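(* Let $\mathbb X$ be a vector space, $\mathbb W$ a set and $R\subset\mathbb W\times\mathbb X$ a correspondence between the sets $\mathbb W$ and $\mathbb X$. Let $h:\mathbb W\to\overline{\mathbb R}$ be a function, and let $C\subset\mathbb X$ be a convex subset such that the function $\inf[h\mid R]:\mathbb X\to\overline{\mathbb R}$ is convex on $C$. Then the minimization problem $\inf_{w\in RC}h(w)$ displays hidden convexity, with $f=\inf[h\mid R]$ (and with this $\mathbb X$ and this $C$) in the definition of hidden convexity: $$\inf_{w\in RC}h(w)=\inf_{x\in C}\inf[h\mid R](x).$$ Moreover, if there exists an optimal solution $x^\star$ to the auxiliary convex minimization problem $\min_{x\in C}\inf[h\mid R](x)$, that is, if $$x^\star\in\arg\min_{x\in C}\inf[h\mid R](x),$$ and if there exists an optimal solution $w^\star$ to the minimization problem $\min_{w\in Rx^\star}h(w)$ (the original minimization problem but with the stronger constraint $w\in Rx^\star$ instead of $w\in RC$), that is, if $$w^\star\in\arg\min_{w\in Rx^\star}h(w),$$ then $w^\star$ is an optimal solution to the original minimization problem $\min_{w\in RC}h(w)$, that is, $$w^\star\in\arg\min_{w\in RC}h(w).$$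
   Context: $\overline{\mathbb R}=[-\infty,+\infty]$; an infimum over the empty set is $+\infty$. A correspondence between sets $\mathbb W$ and $\mathbb X$ is a subset $R\subset\mathbb W\times\mathbb X$; write $wRx$ for $(w,x)\in R$. Foresets: $Rx=\{w\in\mathbb W: wRx\}$ for $x\in\mathbb X$, and $RC=\{w\in\mathbb W:\exists x\in C,\ wRx\}$ for $C\subset\mathbb X$. Conditional infimum of $h$ with respect to $R$: the function $\inf[h\mid R]:\mathbb X\to\overline{\mathbb R}$ given by $\inf[h\mid R](x)=\inf_{w\in Rx}h(w)$, for $x\in\mathbb X$. Hidden convexity: for a set $\mathbb W$, a function $h:\mathbb W\to\overline{\mathbb R}$ and a subset $W\subset\mathbb W$, the minimization problem $\inf_{w\in W}h(w)$ displays hidden convexity if there exist a vector space $\mathbb X$, a convex function $f:\mathbb X\to\overline{\mathbb R}$ and a convex subset $C\subset\mathbb X$ such that $\inf_{w\in W}h(w)=\inf_{x\in C}f(x)$.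
   Formalization: Since inf[h|R] is assumed convex only on C, it need not be a convex function on X; the f in the definition of hidden convexity is taken to be inf[h|R] on C and +∞ outside C, while the equality of infima is stated for inf[h|R] itself. *)

theory Defs
  imports "HOL-Analysis.Analysis"
begin

definition foreset :: "('w \<times> 'x) set \<Rightarrow> 'x \<Rightarrow> 'w set" where
  "foreset R x = {w. (w, x) \<in> R}"

definition foreset_of_set :: "('w \<times> 'x) set \<Rightarrow> 'x set \<Rightarrow> 'w set" where
  "foreset_of_set R C = {w. \<exists>x\<in>C. (w, x) \<in> R}"

text \<open>In \<^typ>\<open>ereal\<close> the infimum over the empty set is \<open>\<infinity>\<close>.\<close>

definition cond_inf :: "('w \<Rightarrow> ereal) \<Rightarrow> ('w \<times> 'x) set \<Rightarrow> 'x \<Rightarrow> ereal" where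
  "cond_inf h R x = (INF w\<in>foreset R x. h w)"

text \<open>
  Convexity of an extended-real-valued function on a set, through its epigraph. The epigraph
  lives over the real line, so no convention for \<open>\<infinity> - \<infinity>\<close> is involved. As for
  \<^const>\<open>convex_on\<close>, the set itself is required to be convex.
\<close>

definition ereal_convex_on :: "'x::real_vector set \<Rightarrow> ('x \<Rightarrow> ereal) \<Rightarrow> bool" where
  "ereal_convex_on S f \<longleftrightarrow>
     convex S \<and> convex {(x, t :: real). x \<in> S \<and> f x \<le> ereal t}"

text \<open>
  Extension by \<open>\<infinity>\<close> outside \<open>C\<close>: turns a function that is convex on \<open>C\<close> only into one that is
  convex on the whole space, as hidden convexity requires, without changing its values on \<open>C\<close>.
\<close>

definition restrict_inf :: "'x set \<Rightarrow> ('x \<Rightarrow> ereal) \<Rightarrow> 'x \<Rightarrow> ereal" where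
  "restrict_inf C f x = (if x \<in> C then f x else \<infinity>)"

definition hidden_convexity_witness ::
    "('x::real_vector \<Rightarrow> ereal) \<Rightarrow> 'x set \<Rightarrow> ('w \<Rightarrow> ereal) \<Rightarrow> 'w set \<Rightarrow> bool" where
  "hidden_convexity_witness f C h W \<longleftrightarrow>
     ereal_convex_on UNIV f \<and> convex C \<and> (INF w\<in>W. h w) = (INF x\<in>C. f x)"

text \<open>
  HOL cannot quantify over types, so the vector space whose existence hidden convexity asserts
  is an explicit type argument.
\<close>

definition displays_hidden_convexity ::
    "'x::real_vector itself \<Rightarrow> ('w \<Rightarrow> ereal) \<Rightarrow> 'w set \<Rightarrow> bool" where
  "displays_hidden_convexity _ h W \<longleftrightarrow>
     (\<exists>(f :: 'x \<Rightarrow> ereal) C. hidden_convexity_witness f C h W)"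

end

theory Submission
  imports Defs
begin

text \<open>The feasible set is the union of the foresets of the points of \<open>C\<close>, so
  minimization splits into two stages: over each foreset, then over \<open>C\<close>
  (\<open>INF_foreset_of_set\<close>). The inner value is convex on \<open>C\<close>; its extension
  by \<infinity> gives the globally convex function that hidden convexity demands
  (\<open>ereal_convex_on_UNIV_restrict_inf\<close>). Minimizers of the two stages compose to a
  minimizer of the original problem (\<open>is_arg_min_foreset_of_set\<close>).\<close>

lemma INF_foreset_of_set:
  "(INF w\<in>foreset_of_set R C. h w) = (INF x\<in>C. cond_inf h R x)"
proof -
  have "foreset_of_set R C = (\<Union>x\<in>C. foreset R x)"
    by (auto simp: foreset_of_set_def foreset_def)
  then show ?thesis
    unfolding cond_inf_def
    \<comment> \<open>Each side is a lower bound for the other in the complete lattice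
      \<open>ereal\<close>; an empty foreset contributes \<infinity>, which leaves the outer infimum
      unchanged.\<close>
    by (auto intro!: antisym INF_greatest intro: INF_lower2 INF_lower)
qed

text \<open>No real \<open>t\<close> lies above \<infinity>, so points outside \<open>C\<close> add
  nothing to the epigraph: it is the epigraph of \<open>f\<close> over \<open>C\<close>, which is
  convex by assumption.\<close>

lemma ereal_convex_on_UNIV_restrict_inf:
  assumes "ereal_convex_on C f"
  shows "ereal_convex_on UNIV (restrict_inf C f)"
proof -
  have "{(x, t :: real). x \<in> UNIV \<and> restrict_inf C f x \<le> ereal t}
      = {(x, t :: real). x \<in> C \<and> f x \<le> ereal t}"
    by (auto simp: restrict_inf_def split: if_splits)
  then show ?thesis
    using assms by (simp add: ereal_convex_on_def)
qed

lemma is_arg_min_foreset_of_set: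
  assumes x: "is_arg_min (cond_inf h R) (\<lambda>x'. x' \<in> C) x"
    and w: "is_arg_min h (\<lambda>w'. w' \<in> foreset R x) w"
  shows "is_arg_min h (\<lambda>w'. w' \<in> foreset_of_set R C) w"
  unfolding is_arg_min_linorder
proof (intro conjI allI impI)
  show "w \<in> foreset_of_set R C"
    using x w by (auto simp: is_arg_min_linorder foreset_of_set_def foreset_def)
next
  fix v assume "v \<in> foreset_of_set R C"
  then obtain y where y: "y \<in> C" "v \<in> foreset R y"
    by (auto simp: foreset_of_set_def foreset_def)
  \<comment> \<open>The chain uses in turn the optimality of \<open>w\<close> in the foreset of
    \<open>x\<close>, the optimality of \<open>x\<close> in \<open>C\<close>, and the membership of
    \<open>v\<close> in the foreset of \<open>y\<close>.\<close>
  have "h w \<le> cond_inf h R x"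
    unfolding cond_inf_def using w by (auto simp: is_arg_min_linorder intro: INF_greatest)
  also have "\<dots> \<le> cond_inf h R y"
    using x y by (simp add: is_arg_min_linorder)
  also have "\<dots> \<le> h v"
    unfolding cond_inf_def using y by (intro INF_lower)
  finally show "h w \<le> h v" .
qed

theorem proposition6:
  fixes R :: "('w \<times> 'x::real_vector) set"
    and h :: "'w \<Rightarrow> ereal"
    and C :: "'x set"
  assumes "convex C"
    and "ereal_convex_on C (cond_inf h R)"
  shows "displays_hidden_convexity TYPE('x) h (foreset_of_set R C)
    \<and> hidden_convexity_witness (restrict_inf C (cond_inf h R)) C h (foreset_of_set R C)
    \<and> (INF w\<in>foreset_of_set R C. h w) = (INF x\<in>C. cond_inf h R x)
    \<and> (\<forall>x w. is_arg_min (cond_inf h R) (\<lambda>x'. x' \<in> C) x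
          \<longrightarrow> is_arg_min h (\<lambda>w'. w' \<in> foreset R x) w
          \<longrightarrow> is_arg_min h (\<lambda>w'. w' \<in> foreset_of_set R C) w)"
proof -
  \<comment> \<open>The extension agrees with the conditional infimum on \<open>C\<close>, so the
    two-stage formula also holds for the witness.\<close>
  have "(INF x\<in>C. restrict_inf C (cond_inf h R) x) = (INF x\<in>C. cond_inf h R x)"
    by (simp add: restrict_inf_def)
  then have witness:
    "hidden_convexity_witness (restrict_inf C (cond_inf h R)) C h (foreset_of_set R C)"
    using assms ereal_convex_on_UNIV_restrict_inf[OF assms(2)]
    by (simp add: hidden_convexity_witness_def INF_foreset_of_set)
  then have "displays_hidden_convexity TYPE('x) h (foreset_of_set R C)"
    by (auto simp: displays_hidden_convexity_def)
  with witness show ?thesis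
    using is_arg_min_foreset_of_set[of h R C] by (auto simp: INF_foreset_of_set)
qed

end
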